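(* Let $\mathbb{L}=(\mathcal{P},\mathcal{C},-)$ be a Laguerre plane, $p$ a point and $K$ a circle with $p\in K$. Let $\Delta=\Delta(p,K)$ be a group of automorphisms of $\mathbb{L}$ that maps the pencil $\langle p,K\rangle$ onto itself and fixes every point of the generator $\overline{p}$, and suppose that (i) $\Delta$ is transitive on $\mathcal{P}\setminus\overline{p}$; (ii) for every $r\in K\setminus\{p\}$ and all $x,y\in K\setminus\{p,r\}$ there is $\sigma\in\Delta_r$ with $\sigma(x)=y$; (iii) for every circle $M$ with $p\notin M$ there is exactly one circle of $\langle p,K\rangle$ tangent to $M$. If $M$ is a circle with $p\notin M$, then $M\setminus\overline{p}=x\sqcup y$, where $x$ is the point of tangency of $M$ with the unique circle of $\langle p,K\rangle$ tangent to $M$ and $y$ is any point of $M$ different from $x$ and from $pM$.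
   Context: A Laguerre plane is a structure $\mathbb{L}=(\mathcal{P},\mathcal{C},-)$ with a set $\mathcal{P}$ of points, a set $\mathcal{C}\subset 2^{\mathcal{P}}$ of circles and an equivalence relation $-$ on $\mathcal{P}$ (parallelity of points), whose classes are called generators; $\overline{p}$ is the generator containing $p$. Axioms: (1) three pairwise nonparallel points lie on a unique circle; (2) for every circle $K$ and nonparallel points $p\in K$, $q\notin K$ there is exactly one circle $L$ through $q$ with $K\cap L=\{p\}$; (3) for any point $p$ and circle $K$ there is exactly one point $q\in K$ with $p-q$; (4) some circle contains at least three points but not all points. Automorphisms are permutations of $\mathcal{P}$ mapping circles to circles and generators to generators. Two circles are tangent (in $p$) if their intersection is a single point ($\{p\}$). For $p\in K$, $\langle p,K\rangle$ is the set consisting of $K$ and all circles tangent to $K$ in $p$. For a point $p$ and circle $M$, $pM$ is the unique point of $M$ parallel to $p$. $\Delta_r$ is the stabilizer of $r$ in $\Delta$. For distinct $x,y\in\mathcal{P}\setminus\overline{p}$, $x\sqcup y=\{x\}\cup\{g(y): g\in\Delta_x\}$. *)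

theory Defs
  imports "HOL-Algebra.Bij"
begin

text \<open>
  A Laguerre plane is given by a point set \<open>P\<close>, a set \<open>C\<close> of circles and the
  parallelity relation \<open>R\<close> on \<open>P\<close>.
\<close>

locale laguerre_plane =
  fixes P :: "'a set" and C :: "'a set set" and R :: "'a rel"
  assumes circles_subset: "C \<subseteq> Pow P"
    and equiv_parallel: "equiv P R"
    and circle_through_three:
      "\<lbrakk>a \<in> P; b \<in> P; c \<in> P; (a, b) \<notin> R; (b, c) \<notin> R; (a, c) \<notin> R\<rbrakk>
        \<Longrightarrow> \<exists>!K. K \<in> C \<and> a \<in> K \<and> b \<in> K \<and> c \<in> K"
    and touching_circle:
      "\<lbrakk>K \<in> C; p \<in> K; q \<in> P; q \<notin> K; (p, q) \<notin> R\<rbrakk>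
        \<Longrightarrow> \<exists>!L. L \<in> C \<and> q \<in> L \<and> K \<inter> L = {p}"
    and parallel_projection:
      "\<lbrakk>p \<in> P; K \<in> C\<rbrakk> \<Longrightarrow> \<exists>!q. q \<in> K \<and> (p, q) \<in> R"
    and rich:
      "\<exists>K\<in>C. K \<noteq> P \<and> (\<exists>a\<in>K. \<exists>b\<in>K. \<exists>c\<in>K. a \<noteq> b \<and> b \<noteq> c \<and> a \<noteq> c)"

definition generator :: "'a rel \<Rightarrow> 'a \<Rightarrow> 'a set" where
  "generator R p = R `` {p}"

definition parallel_point :: "'a rel \<Rightarrow> 'a \<Rightarrow> 'a set \<Rightarrow> 'a" where
  "parallel_point R p M = (THE q. q \<in> M \<and> (p, q) \<in> R)"

definition tangent_in :: "'a \<Rightarrow> 'a set \<Rightarrow> 'a set \<Rightarrow> bool" where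
  "tangent_in p K L \<longleftrightarrow> K \<inter> L = {p}"

definition tangent :: "'a set \<Rightarrow> 'a set \<Rightarrow> bool" where
  "tangent K L \<longleftrightarrow> (\<exists>p. tangent_in p K L)"

definition pencil :: "'a set set \<Rightarrow> 'a \<Rightarrow> 'a set \<Rightarrow> 'a set set" where
  "pencil C p K = insert K {L \<in> C. tangent_in p K L}"

text \<open>
  The elements of \<^term>\<open>Bij P\<close> are the bijections of \<open>P\<close> onto itself, taken to be
  \<open>undefined\<close> outside \<open>P\<close>; they are the carrier of the group \<^term>\<open>BijGroup P\<close>.
\<close>

definition laguerre_automorphisms :: "'a set \<Rightarrow> 'a set set \<Rightarrow> 'a rel \<Rightarrow> ('a \<Rightarrow> 'a) set" where
  "laguerre_automorphisms P C R =
    {f \<in> Bij P. (\<forall>K\<in>C. f ` K \<in> C) \<and> (\<forall>G\<in>P // R. f ` G \<in> P // R)}"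

definition point_stabilizer :: "('a \<Rightarrow> 'a) set \<Rightarrow> 'a \<Rightarrow> ('a \<Rightarrow> 'a) set" where
  "point_stabilizer \<Delta> r = {g \<in> \<Delta>. g r = r}"

definition orbit_join :: "('a \<Rightarrow> 'a) set \<Rightarrow> 'a \<Rightarrow> 'a \<Rightarrow> 'a set" where
  "orbit_join \<Delta> x y = {x} \<union> {g y | g. g \<in> point_stabilizer \<Delta> x}"

end

theory Submission
  imports Defs
begin

text \<open>
  Two observations carry the proof. An element of \<open>\<Delta>\<close> that fixes \<open>x\<close> maps \<open>L\<close> to a
  circle of the pencil through \<open>x\<close>, and distinct circles of the pencil meet only on the
  generator of \<open>p\<close>, so it maps \<open>L\<close> to itself. It also fixes the point \<open>q\<close> of \<open>M\<close>
  parallel to \<open>p\<close>, because \<open>\<Delta>\<close> fixes that whole generator. Since \<open>M\<close> is the only circle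
  through \<open>q\<close> that touches \<open>L\<close> in \<open>x\<close>, it is mapped to itself as well
  (\<open>touching_circle_invariant\<close>). Hence the orbit of \<open>y\<close> stays on \<open>M\<close>.

  Conversely, transitivity outside the generator of \<open>p\<close> lets one move \<open>x\<close> onto \<open>K\<close>, and then
  \<open>L\<close> onto \<open>K\<close>, so that conjugation carries the assumed transitivity of the stabilizers on
  \<open>K\<close> over to \<open>L\<close> (\<open>stabilizer_transitive_on_pencil\<close>). For a point \<open>z\<close> of \<open>M\<close> other than \<open>x\<close>
  and \<open>q\<close>, project \<open>y\<close> and \<open>z\<close> along their generators to \<open>L\<close> and choose an element of the
  stabilizer of \<open>x\<close> that maps the one projection to the other. It maps generators to generators and
  leaves \<open>M\<close> invariant, so the image of \<open>y\<close> is the point of \<open>M\<close> on the generator of \<open>z\<close>, which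
  is \<open>z\<close>.
\<close>

lemma subgroup_BijGroup_compose:
  assumes "subgroup \<Delta> (BijGroup S)" "f \<in> \<Delta>" "g \<in> \<Delta>"
  shows "compose S f g \<in> \<Delta>"
proof -
  have "f \<otimes>\<^bsub>BijGroup S\<^esub> g \<in> \<Delta>"
    using assms by (rule subgroup.m_closed)
  moreover have "f \<in> Bij S" "g \<in> Bij S"
    using subgroup.subset[OF assms(1)] assms(2,3) by (auto simp: BijGroup_def)
  ultimately show ?thesis by (simp add: BijGroup_def)
qed

lemma subgroup_BijGroup_inverse:
  assumes "subgroup \<Delta> (BijGroup S)" "f \<in> \<Delta>"
  obtains g where "g \<in> \<Delta>" "\<And>v. v \<in> S \<Longrightarrow> g (f v) = v"
proof
  have f: "f \<in> Bij S"
    using subgroup.subset[OF assms(1)] assms(2) by (auto simp: BijGroup_def)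
  show "restrict (inv_into S f) S \<in> \<Delta>"
    using subgroup.m_inv_closed[OF assms] f by (simp add: inv_BijGroup)
  show "restrict (inv_into S f) S (f v) = v" if "v \<in> S" for v
    using f that by (auto simp: Bij_def bij_betw_def)
qed

context laguerre_plane
begin

lemma circle_point_in_points: "N \<in> C \<Longrightarrow> a \<in> N \<Longrightarrow> a \<in> P"
  using circles_subset by blast

lemma parallel_points_on_circle_eq:
  assumes "N \<in> C" "a \<in> N" "b \<in> N" "(a, b) \<in> R"
  shows "a = b"
proof -
  have "a \<in> P"
    using assms(1,2) by (rule circle_point_in_points)
  then have "(a, a) \<in> R" "\<exists>!q. q \<in> N \<and> (a, q) \<in> R"
    using equiv_class_self[OF equiv_parallel] parallel_projection assms(1) by auto
  then show ?thesis
    using assms(2-4) by blast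
qed

lemma parallel_point_on_circle:
  assumes "a \<in> P" "N \<in> C"
  shows "parallel_point R a N \<in> N" "(a, parallel_point R a N) \<in> R"
  using theI'[OF parallel_projection[OF assms]] by (simp_all add: parallel_point_def)

lemma parallel_point_eq:
  assumes "a \<in> P" "N \<in> C" "b \<in> N" "(a, b) \<in> R"
  shows "parallel_point R a N = b"
  using the1_equality[OF parallel_projection[OF assms(1,2)]] assms(3,4)
  by (simp add: parallel_point_def)

lemma automorphism_inj: "g \<in> laguerre_automorphisms P C R \<Longrightarrow> inj_on g P"
  by (simp add: laguerre_automorphisms_def Bij_def bij_betw_def)

lemma automorphism_parallel:
  assumes g: "g \<in> laguerre_automorphisms P C R" and ab: "(a, b) \<in> R"
  shows "(g a, g b) \<in> R"
proof -
  have P: "a \<in> P" "b \<in> P"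
    using ab equiv_parallel by (auto simp: equiv_def refl_on_def)
  have "g ` (R `` {a}) \<in> P // R"
    using g quotientI[OF P(1)] unfolding laguerre_automorphisms_def by blast
  moreover have "g a \<in> g ` (R `` {a})"
    using equiv_class_self[OF equiv_parallel P(1)] by blast
  moreover have "g b \<in> g ` (R `` {a})"
    using ab by blast
  ultimately show ?thesis
    using quotient_eq_iff[OF equiv_parallel] by metis
qed

lemma pencil_circle: "K \<in> C \<Longrightarrow> p \<in> K \<Longrightarrow> N \<in> pencil C p K \<Longrightarrow> N \<in> C \<and> p \<in> N"
  by (auto simp: pencil_def tangent_in_def)

text \<open>
  The axiom of touching circles leaves only one circle tangent to \<open>K\<close> in \<open>p\<close> through a point
  off \<open>K\<close> that is not parallel to \<open>p\<close>. Hence a member of the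
  pencil is determined by any one of its points outside the generator of \<open>p\<close>; this is how an
  automorphism that permutes the pencil is seen to map one given member to another.
\<close>

lemma pencil_circle_unique:
  assumes K: "K \<in> C" "p \<in> K"
    and N: "N \<in> pencil C p K" "N' \<in> pencil C p K"
    and a: "a \<in> N" "a \<in> N'" "a \<notin> generator R p"
  shows "N = N'"
proof (cases "a \<in> K")
  case True
  \<comment> \<open>A circle tangent to \<open>K\<close> in \<open>p\<close> has no second point on \<open>K\<close>.\<close>
  have "a \<noteq> p"
    using a(3) equiv_class_self[OF equiv_parallel] circle_point_in_points[OF K]
    by (auto simp: generator_def)
  then show ?thesis
    using N a True by (auto simp: pencil_def tangent_in_def)
next
  case False
  have "a \<in> P"
    using pencil_circle[OF K N(1)] a(1) circle_point_in_points by blast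
  moreover have "(p, a) \<notin> R"
    using a(3) by (simp add: generator_def)
  ultimately have "\<exists>!T. T \<in> C \<and> a \<in> T \<and> K \<inter> T = {p}"
    using touching_circle K False by blast
  then show ?thesis
    using N a False unfolding pencil_def tangent_in_def by blast
qed

text \<open>
  Through a point \<open>q\<close> off \<open>N\<close> and not parallel to \<open>x\<close> there is only one circle touching \<open>N\<close>
  in \<open>x\<close>. So \<open>M\<close> is recovered from \<open>N\<close>, \<open>x\<close> and \<open>q\<close>, all of which \<open>g\<close> fixes.
\<close>

lemma touching_circle_invariant:
  assumes g: "g \<in> laguerre_automorphisms P C R"
    and circles: "N \<in> C" "M \<in> C" and tangent: "tangent_in x N M"
    and N: "g ` N = N" and x: "g x = x"
    and q: "q \<in> M" "q \<noteq> x" "g q = q"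
  shows "g ` M = M"
proof -
  have NM: "N \<inter> M = {x}"
    using tangent by (simp add: tangent_in_def)
  have "g ` (N \<inter> M) = g ` N \<inter> g ` M"
    using inj_on_image_Int[OF automorphism_inj[OF g]] circles circles_subset by blast
  then have image: "N \<inter> g ` M = {x}"
    using NM N x by simp
  have gM: "g ` M \<in> C" "q \<in> g ` M"
    using g circles(2) q(1) imageI[OF q(1), of g] q(3) by (auto simp: laguerre_automorphisms_def)
  have "q \<in> P" "q \<notin> N" "(x, q) \<notin> R"
    using q NM parallel_points_on_circle_eq[OF circles(2)] circles(2) circle_point_in_points
    by blast+
  then have "\<exists>!T. T \<in> C \<and> q \<in> T \<and> N \<inter> T = {x}"
    using touching_circle[OF circles(1)] NM by blast
  then show ?thesis
    using gM image circles(2) q(1) NM by blast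
qed

text \<open>
  All circles of the pencil are equivalent under \<open>\<Delta>\<close>: moving one point of \<open>L\<close> outside the
  generator of \<open>p\<close> to \<open>K\<close> forces \<open>L\<close> to be mapped to \<open>K\<close>, and conjugating by this motion
  transports the stabilizers.
\<close>

lemma stabilizer_transitive_on_pencil:
  assumes K: "K \<in> C" "p \<in> K"
    and group: "subgroup \<Delta> (BijGroup P)" "\<Delta> \<subseteq> laguerre_automorphisms P C R"
    and pencil_invariant: "\<forall>g\<in>\<Delta>. (\<lambda>N. g ` N) ` pencil C p K = pencil C p K"
    and generator_fixed: "\<forall>g\<in>\<Delta>. \<forall>q\<in>generator R p. g q = q"
    and transitive:
      "\<forall>a\<in>P - generator R p. \<forall>b\<in>P - generator R p. \<exists>g\<in>\<Delta>. g a = b"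
    and stabilizer_transitive:
      "\<forall>r\<in>K - {p}. \<forall>a\<in>K - {p, r}. \<forall>b\<in>K - {p, r}. \<exists>\<sigma>\<in>point_stabilizer \<Delta> r. \<sigma> a = b"
    and L: "L \<in> pencil C p K"
    and x: "x \<in> L - {p}" and a: "a \<in> L - {p, x}" and b: "b \<in> L - {p, x}"
  obtains \<tau> where "\<tau> \<in> point_stabilizer \<Delta> x" "\<tau> a = b"
proof -
  have LC: "L \<in> C" "p \<in> L"
    using pencil_circle[OF K L] by auto
  have P: "p \<in> P" "x \<in> P" "a \<in> P" "b \<in> P"
    using circle_point_in_points[OF LC(1)] LC(2) x a b by auto
  have outside: "v \<notin> generator R p" if "N \<in> C" "p \<in> N" "v \<in> N" "v \<noteq> p" for N v
    using parallel_points_on_circle_eq[OF that(1-3)] that(4) by (auto simp: generator_def)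
  \<comment> \<open>Any point of \<open>K\<close> other than \<open>p\<close> serves as the target of \<open>x\<close>; the projection of \<open>x\<close> is one.\<close>
  define r where "r = parallel_point R x K"
  have r: "r \<in> K" "(x, r) \<in> R"
    using parallel_point_on_circle[OF P(2) K(1)] by (simp_all add: r_def)
  have "r \<noteq> p"
    using r(2) parallel_points_on_circle_eq[OF LC(1), of x p] LC(2) x by auto
  then have r_outside: "r \<in> P - generator R p"
    using outside[OF K r(1)] circle_point_in_points[OF K(1) r(1)] by blast
  obtain h where h: "h \<in> \<Delta>" "h x = r"
    using transitive r_outside outside[OF LC] x P(2) by blast
  have "h ` L \<in> pencil C p K"
    using pencil_invariant h(1) L by blast
  moreover have "K \<in> pencil C p K"
    by (simp add: pencil_def)
  moreover have "r \<in> h ` L"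
    using h(2) x by blast
  ultimately have hL: "h ` L = K"
    using pencil_circle_unique[OF K] r(1) r_outside by blast
  have "p \<in> generator R p"
    using equiv_class_self[OF equiv_parallel P(1)] by (simp add: generator_def)
  then have "h p = p"
    using generator_fixed h(1) by blast
  moreover have "inj_on h P"
    using automorphism_inj h(1) group(2) by blast
  ultimately have "h v \<in> K - {p, r}" if "v \<in> L - {p, x}" for v
    using that hL h(2) P(1,2) circle_point_in_points[OF LC(1), of v] inj_on_eq_iff[of h P]
    by fastforce
  then obtain \<sigma> where \<sigma>: "\<sigma> \<in> \<Delta>" "\<sigma> r = r" "\<sigma> (h a) = h b"
    using stabilizer_transitive r(1) \<open>r \<noteq> p\<close> a b unfolding point_stabilizer_def by blast
  obtain k where k: "k \<in> \<Delta>" "\<And>v. v \<in> P \<Longrightarrow> k (h v) = v"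
    using subgroup_BijGroup_inverse[OF group(1) h(1)] by blast
  show thesis
  proof
    let ?\<tau> = "compose P k (compose P \<sigma> h)"
    have "?\<tau> \<in> \<Delta>"
      using subgroup_BijGroup_compose[OF group(1)] k(1) \<sigma>(1) h(1) by blast
    moreover have "?\<tau> x = x"
      using P(2) h(2) \<sigma>(2) k(2)[OF P(2)] by (simp add: compose_eq)
    ultimately show "?\<tau> \<in> point_stabilizer \<Delta> x"
      by (simp add: point_stabilizer_def)
    show "?\<tau> a = b"
      using P \<sigma>(3) k(2)[OF P(4)] by (simp add: compose_eq)
  qed
qed

end

theorem proposition2p4:
  fixes P :: "'a set" and C :: "'a set set" and R :: "'a rel"
    and p :: 'a and K :: "'a set" and \<Delta> :: "('a \<Rightarrow> 'a) set"
    and M :: "'a set" and L :: "'a set" and x :: 'a and y :: 'a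
  assumes plane: "laguerre_plane P C R"
    and circle: "K \<in> C" "p \<in> K"
    and group: "subgroup \<Delta> (BijGroup P)" "\<Delta> \<subseteq> laguerre_automorphisms P C R"
    and pencil_invariant: "\<forall>g\<in>\<Delta>. (\<lambda>N. g ` N) ` pencil C p K = pencil C p K"
    and generator_fixed: "\<forall>g\<in>\<Delta>. \<forall>q\<in>generator R p. g q = q"
    and transitive:
      "\<forall>a\<in>P - generator R p. \<forall>b\<in>P - generator R p. \<exists>g\<in>\<Delta>. g a = b"
    and stabilizer_transitive:
      "\<forall>r\<in>K - {p}. \<forall>a\<in>K - {p, r}. \<forall>b\<in>K - {p, r}. \<exists>\<sigma>\<in>point_stabilizer \<Delta> r. \<sigma> a = b"
    and unique_tangent:
      "\<forall>N\<in>C. p \<notin> N \<longrightarrow> (\<exists>!T. T \<in> pencil C p K \<and> tangent T N)"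
    and M: "M \<in> C" "p \<notin> M"
    and L: "L \<in> pencil C p K" "tangent_in x L M"
    and y: "y \<in> M" "y \<noteq> x" "y \<noteq> parallel_point R p M"
  shows "M - generator R p = orbit_join \<Delta> x y"
proof -
  interpret laguerre_plane P C R by (rule plane)
  have LC: "L \<in> C" "p \<in> L"
    using pencil_circle[OF circle L(1)] by auto
  have LM: "L \<inter> M = {x}"
    using L(2) by (simp add: tangent_in_def)
  have P: "p \<in> P" "x \<in> P" "y \<in> P"
    using circle_point_in_points LC M(1) y(1) LM by blast+
  define q where "q = parallel_point R p M"
  have q: "q \<in> M" "(p, q) \<in> R"
    using parallel_point_on_circle[OF P(1) M(1)] by (simp_all add: q_def)
  have M_outside: "v \<notin> generator R p \<longleftrightarrow> v \<noteq> q" if "v \<in> M" for v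
    using parallel_point_eq[OF P(1) M(1) that] q(2) by (auto simp: generator_def q_def)
  have "x \<noteq> p"
    using LM M(2) by blast
  then have "x \<noteq> q"
    using parallel_points_on_circle_eq[OF LC] LM q(2) by blast
  then have x_outside: "x \<notin> generator R p"
    using M_outside LM by blast
  have M_invariant: "g ` M = M" if "g \<in> \<Delta>" "g x = x" for g
  proof (rule touching_circle_invariant[where g = g and x = x and q = q,
        OF _ LC(1) M(1) L(2) _ that(2) q(1)])
    show "g \<in> laguerre_automorphisms P C R"
      using that(1) group(2) by blast
    have "g ` L \<in> pencil C p K" "x \<in> g ` L"
      using pencil_invariant that L(1) LM by (blast, force)
    then show "g ` L = L"
      using pencil_circle_unique[OF circle _ L(1)] LM x_outside by blast
    show "q \<noteq> x"
      using \<open>x \<noteq> q\<close> by simp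
    show "g q = q"
      using generator_fixed that(1) q(2) by (simp add: generator_def)
  qed
  show ?thesis
  proof (rule equalityI; rule subsetI)
    fix z
    assume "z \<in> M - generator R p"
    then have z: "z \<in> M" "z \<noteq> q"
      using M_outside by auto
    show "z \<in> orbit_join \<Delta> x y"
    proof (cases "z = x")
      case False
      have projection: "parallel_point R v L \<in> L - {p, x}" "(v, parallel_point R v L) \<in> R"
        if v: "v \<in> M" "v \<noteq> x" "v \<noteq> q" for v
      proof -
        have vP: "v \<in> P"
          using circle_point_in_points[OF M(1) v(1)] .
        show par: "(v, parallel_point R v L) \<in> R"
          using parallel_point_on_circle[OF vP LC(1)] by blast
        have "(v, x) \<notin> R"
          using parallel_points_on_circle_eq[OF M(1) v(1)] LM v(2) by blast
        moreover have "(v, p) \<notin> R"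
          using M_outside[OF v(1)] v(3) equiv_parallel
          by (auto simp: generator_def equiv_def dest: symD)
        ultimately show "parallel_point R v L \<in> L - {p, x}"
          using parallel_point_on_circle(1)[OF vP LC(1)] par by auto
      qed
      have y': "y \<noteq> q"
        using y(3) by (simp add: q_def)
      obtain \<tau> where \<tau>: "\<tau> \<in> point_stabilizer \<Delta> x"
        and map: "\<tau> (parallel_point R y L) = parallel_point R z L"
        using stabilizer_transitive_on_pencil[OF circle group pencil_invariant generator_fixed
            transitive stabilizer_transitive L(1) _
            projection(1)[OF y(1,2) y'] projection(1)[OF z(1) False z(2)]]
          LM \<open>x \<noteq> p\<close> by blast
      have \<tau>': "\<tau> \<in> \<Delta>" "\<tau> x = x"
        using \<tau> by (simp_all add: point_stabilizer_def)
      have "(\<tau> y, parallel_point R z L) \<in> R"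
        using automorphism_parallel[of \<tau>] \<tau>'(1) group(2) projection(2)[OF y(1,2) y'] map
        by (metis subsetD)
      then have "(\<tau> y, z) \<in> R"
        using projection(2)[OF z(1) False z(2)] equiv_parallel
        by (meson equivE symD transD)
      moreover have "\<tau> y \<in> M"
        using M_invariant[OF \<tau>'] y(1) by blast
      ultimately have "\<tau> y = z"
        using parallel_points_on_circle_eq[OF M(1)] z(1) by blast
      then show ?thesis
        using \<tau> by (auto simp: orbit_join_def)
    qed (simp add: orbit_join_def)
  next
    fix z
    assume "z \<in> orbit_join \<Delta> x y"
    then consider "z = x" | g where "g \<in> \<Delta>" "g x = x" "z = g y"
      by (auto simp: orbit_join_def point_stabilizer_def)
    then show "z \<in> M - generator R p"
    proof cases
      case 1
      then show ?thesis
        using LM x_outside by blast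
    next
      case 2
      have "z \<in> M"
        using M_invariant[OF 2(1,2)] 2(3) y(1) by blast
      moreover have "z \<noteq> q"
      proof
        assume "z = q"
        moreover have "g q = q"
          using 2(1) generator_fixed q(2) by (simp add: generator_def)
        ultimately have "g y = g q"
          using 2(3) by simp
        moreover have "inj_on g P"
          using automorphism_inj 2(1) group(2) by blast
        ultimately have "y = q"
          using P(3) circle_point_in_points[OF M(1) q(1)] by (meson inj_onD)
        then show False
          using y(3) by (simp add: q_def)
      qed
      ultimately show ?thesis
        using M_outside by blast
    qed
  qed
qed

end
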